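(* Let $b_i$ and $\varepsilon_{ij}$, $1\le i\le n$, $1\le j\le l_i$, be the random effects and errors of the linear mixed model described in the context, and put $e_{ij}=b_i+\varepsilon_{ij}$. For integers $1\le m\le k$ and $1\le i\le n$ let $$f_m^k(i)=\sum_{j=1}^{l_i}e_{ij}^m\Biggl[\sum_{j=1}^{l_i}e_{ij}\Biggr]^{k-m}.$$ Then $$f_m^k(i)=\sum_{t=0}^k\ \sum_{s=(t-k+m)\vee0}^{t\wedge m}\binom ms\binom{k-m}{t-s}\Biggl(\sum_{j=1}^{l_i}\varepsilon_{ij}^s\Biggr)\Biggl(\sum_{j=1}^{l_i}\varepsilon_{ij}\Biggr)^{t-s}b_i^{k-t}\,l_i^{k-m-t+s}.$$
   Context: Model: $y_{ij}=\alpha+x_{ij}'\beta+b_i+\varepsilon_{ij}$, $1\le i\le n$, $1\le j\le l_i$, where $l_i\ge1$ are integers (group sizes), $x_{ij}\in\mathbb R^p$, $\alpha\in\mathbb R$, $\beta\in\mathbb R^p$; $b_1,\dots,b_n$ are i.i.d. real random variables independent of all $\varepsilon_{ij}$, the $\varepsilon_{ij}$ are i.i.d. real random variables, and $\mathbb E b_i=0=\mathbb E\varepsilon_{ij}$. The notation $a\wedge b$ and $a\vee b$ denotes the minimum and maximum of the real numbers $a$ and $b$. In $f_m^k(i)$ the superscript $k$ is an index, not a power. Zeroth powers are interpreted as $1$ (including $0^0=1$). *)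

theory Defs
  imports "HOL-Probability.Probability"
begin

(* The independence of the effects from all the errors is the independence of the sigma-algebras
   generated by the random vectors (b_i)_i and (eps_ij)_ij (indep_var does not apply, because the
   two vectors have different types). Together with the independence within each family this makes
   all the b_i and eps_ij jointly independent.
   Measurability of the b_i and eps_ij is part of indep_vars. *)
locale linear_mixed_model = prob_space M
  for M :: "'w measure" +
  fixes n :: nat
    and l :: "nat \<Rightarrow> nat"
    and x :: "nat \<Rightarrow> nat \<Rightarrow> real ^ 'p"
    and \<alpha> :: real
    and \<beta> :: "real ^ 'p"
    and b :: "nat \<Rightarrow> 'w \<Rightarrow> real"
    and \<epsilon> :: "nat \<Rightarrow> nat \<Rightarrow> 'w \<Rightarrow> real"
    and y :: "nat \<Rightarrow> nat \<Rightarrow> 'w \<Rightarrow> real"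
  assumes group_size: "\<And>i. i \<in> {1..n} \<Longrightarrow> 1 \<le> l i"
    and model: "\<And>i j \<omega>. i \<in> {1..n} \<Longrightarrow> j \<in> {1..l i} \<Longrightarrow> \<omega> \<in> space M \<Longrightarrow>
      y i j \<omega> = \<alpha> + x i j \<bullet> \<beta> + b i \<omega> + \<epsilon> i j \<omega>"
    and effects_indep: "indep_vars (\<lambda>_. borel) b {1..n}"
    and effects_ident: "\<And>i i'. i \<in> {1..n} \<Longrightarrow> i' \<in> {1..n} \<Longrightarrow>
      distr M borel (b i) = distr M borel (b i')"
    and errors_indep: "indep_vars (\<lambda>_. borel) (\<lambda>(i, j). \<epsilon> i j) (SIGMA i:{1..n}. {1..l i})"
    and errors_ident: "\<And>i j i' j'. i \<in> {1..n} \<Longrightarrow> j \<in> {1..l i} \<Longrightarrow>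
      i' \<in> {1..n} \<Longrightarrow> j' \<in> {1..l i'} \<Longrightarrow>
      distr M borel (\<epsilon> i j) = distr M borel (\<epsilon> i' j')"
    and effects_errors_indep:
      "indep_set
        (sets (vimage_algebra (space M) (\<lambda>\<omega>. \<lambda>i\<in>{1..n}. b i \<omega>) (\<Pi>\<^sub>M i\<in>{1..n}. borel)))
        (sets (vimage_algebra (space M)
          (\<lambda>\<omega>. \<lambda>ij\<in>(SIGMA i:{1..n}. {1..l i}). \<epsilon> (fst ij) (snd ij) \<omega>)
          (\<Pi>\<^sub>M ij\<in>(SIGMA i:{1..n}. {1..l i}). borel)))"
    and effects_integrable: "\<And>i. i \<in> {1..n} \<Longrightarrow> integrable M (b i)"
    and effects_mean: "\<And>i. i \<in> {1..n} \<Longrightarrow> expectation (b i) = 0"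
    and errors_integrable: "\<And>i j. i \<in> {1..n} \<Longrightarrow> j \<in> {1..l i} \<Longrightarrow> integrable M (\<epsilon> i j)"
    and errors_mean: "\<And>i j. i \<in> {1..n} \<Longrightarrow> j \<in> {1..l i} \<Longrightarrow> expectation (\<epsilon> i j) = 0"

definition total_error ::
  "(nat \<Rightarrow> 'w \<Rightarrow> real) \<Rightarrow> (nat \<Rightarrow> nat \<Rightarrow> 'w \<Rightarrow> real) \<Rightarrow> nat \<Rightarrow> nat \<Rightarrow> 'w \<Rightarrow> real"
  where "total_error b \<epsilon> i j \<omega> = b i \<omega> + \<epsilon> i j \<omega>"

(* Only used for m \<le> k, so that the subtraction of naturals does not truncate. *)
definition power_sum_product ::
  "(nat \<Rightarrow> nat) \<Rightarrow> (nat \<Rightarrow> nat \<Rightarrow> 'w \<Rightarrow> real) \<Rightarrow> nat \<Rightarrow> nat \<Rightarrow> nat \<Rightarrow> 'w \<Rightarrow> real"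
  where "power_sum_product l e m k i \<omega> =
    (\<Sum>j=1..l i. e i j \<omega> ^ m) * (\<Sum>j=1..l i. e i j \<omega>) ^ (k - m)"

end

theory Submission
  imports Defs
begin

text \<open>The identity is pointwise algebra: fix \<^term>\<open>\<omega>\<close> and the group \<^term>\<open>i\<close>, and let
  \<^term>\<open>b\<close> stand for the random effect, which is the same for all members of the group.
  Expanding each \<open>(b + \<epsilon> j) ^ m\<close> binomially and exchanging the two sums gives a polynomial in
  \<open>b\<close> whose coefficients are the power sums of the errors
  (\<open>sum_power_shift\<close>). On the other hand
  \<open>\<Sum>j (b + \<epsilon> j) = l b + \<Sum>j \<epsilon> j\<close>, so its power \<open>k - m\<close> expands by a single use of the binomial
  theorem (\<open>power_sum_shift\<close>). The product of the two expansions is a sum over the exponents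
  \<open>s \<le> m\<close> and \<open>r \<le> k - m\<close> of the errors in the two factors, and collecting the terms of equal
  total error degree \<open>t = s + r\<close> gives the stated double sum. The bounds
  \<open>max (t - (k - m)) 0\<close> and \<open>min t m\<close> on \<open>s\<close> say exactly that \<open>0 \<le> r \<le> k - m\<close> and \<open>0 \<le> s \<le> m\<close>
  (\<open>sum_rectangle_by_diagonals\<close>).\<close>

text \<open>The truncation of the natural-number difference \<^term>\<open>t - q\<close> at zero is intended: it is the
  lower bound \<open>max (t - q) 0\<close> of the diagonal \<open>s + r = t\<close> in the rectangle.\<close>

lemma sum_rectangle_by_diagonals:
  fixes g :: "nat \<Rightarrow> nat \<Rightarrow> 'a::comm_monoid_add"
  shows "(\<Sum>s\<le>m. \<Sum>r\<le>q. g s r) = (\<Sum>t\<le>m + q. \<Sum>s=t - q..min t m. g s (t - s))"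
proof -
  have "(\<Sum>s\<le>m. \<Sum>r\<le>q. g s r) = (\<Sum>(s, r)\<in>{..m} \<times> {..q}. g s r)"
    by (simp add: sum.cartesian_product)
  also have "\<dots> = (\<Sum>(t, s)\<in>(SIGMA t:{..m + q}. {t - q..min t m}). g s (t - s))"
    by (rule sum.reindex_bij_witness
        [where i = "\<lambda>(t, s). (s, t - s)" and j = "\<lambda>(s, r). (s + r, s)"]) auto
  also have "\<dots> = (\<Sum>t\<le>m + q. \<Sum>s=t - q..min t m. g s (t - s))"
    by (simp add: sum.Sigma)
  finally show ?thesis .
qed

lemma sum_power_shift:
  fixes a :: "'a::comm_semiring_1" and f :: "'i \<Rightarrow> 'a"
  shows "(\<Sum>j\<in>A. (a + f j) ^ m) = (\<Sum>s\<le>m. of_nat (m choose s) * (\<Sum>j\<in>A. f j ^ s) * a ^ (m - s))"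
proof -
  have "(\<Sum>j\<in>A. (a + f j) ^ m) = (\<Sum>j\<in>A. \<Sum>s\<le>m. of_nat (m choose s) * f j ^ s * a ^ (m - s))"
    by (simp add: add.commute[of a] binomial_ring)
  also have "\<dots> = (\<Sum>s\<le>m. \<Sum>j\<in>A. of_nat (m choose s) * f j ^ s * a ^ (m - s))"
    by (rule sum.swap)
  finally show ?thesis
    by (simp add: sum_distrib_left sum_distrib_right)
qed

lemma power_sum_shift:
  fixes a :: "'a::comm_semiring_1" and f :: "'i \<Rightarrow> 'a"
  shows "(\<Sum>j\<in>A. a + f j) ^ q =
    (\<Sum>r\<le>q. of_nat (q choose r) * (\<Sum>j\<in>A. f j) ^ r * a ^ (q - r) * of_nat (card A) ^ (q - r))"
proof -
  have "(\<Sum>j\<in>A. a + f j) = (\<Sum>j\<in>A. f j) + of_nat (card A) * a"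
    by (simp add: sum.distrib add.commute)
  then show ?thesis
    by (simp add: binomial_ring power_mult_distrib mult_ac)
qed

text \<open>A term of the product in which the errors have degrees \<^term>\<open>s\<close> and \<^term>\<open>t - s\<close> in the
  two factors carries \<open>a ^ (m - s)\<close> from the first and \<open>a ^ (q - (t - s))\<close> from the second, so
  its power of \<^term>\<open>a\<close> depends on \<^term>\<open>t\<close> alone. This is why sorting by \<^term>\<open>t\<close> is the same as
  sorting by powers of \<^term>\<open>a\<close>.\<close>

lemma power_sum_product_shift:
  fixes a :: "'a::comm_semiring_1" and f :: "'i \<Rightarrow> 'a"
  shows "(\<Sum>j\<in>A. (a + f j) ^ m) * (\<Sum>j\<in>A. a + f j) ^ q =
    (\<Sum>t\<le>m + q. \<Sum>s=t - q..min t m.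
      of_nat (m choose s) * of_nat (q choose (t - s))
        * (\<Sum>j\<in>A. f j ^ s) * (\<Sum>j\<in>A. f j) ^ (t - s)
        * a ^ (m + q - t) * of_nat (card A) ^ (q - (t - s)))"
proof -
  define g where "g s r = of_nat (m choose s) * (\<Sum>j\<in>A. f j ^ s) * a ^ (m - s)
    * (of_nat (q choose r) * (\<Sum>j\<in>A. f j) ^ r * a ^ (q - r) * of_nat (card A) ^ (q - r))" for s r
  have "(\<Sum>j\<in>A. (a + f j) ^ m) * (\<Sum>j\<in>A. a + f j) ^ q = (\<Sum>s\<le>m. \<Sum>r\<le>q. g s r)"
    unfolding sum_power_shift power_sum_shift sum_product g_def ..
  also have "\<dots> = (\<Sum>t\<le>m + q. \<Sum>s=t - q..min t m. g s (t - s))"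
    by (rule sum_rectangle_by_diagonals)
  also have "\<dots> = (\<Sum>t\<le>m + q. \<Sum>s=t - q..min t m.
      of_nat (m choose s) * of_nat (q choose (t - s))
        * (\<Sum>j\<in>A. f j ^ s) * (\<Sum>j\<in>A. f j) ^ (t - s)
        * a ^ (m + q - t) * of_nat (card A) ^ (q - (t - s)))"
  proof (intro sum.cong refl)
    fix t s assume "t \<in> {..m + q}" and s: "s \<in> {t - q..min t m}"
    then have "m + q - t = (m - s) + (q - (t - s))"
      by auto
    then have "a ^ (m + q - t) = a ^ (m - s) * a ^ (q - (t - s))"
      by (simp add: power_add)
    then show "g s (t - s) = of_nat (m choose s) * of_nat (q choose (t - s))
        * (\<Sum>j\<in>A. f j ^ s) * (\<Sum>j\<in>A. f j) ^ (t - s)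
        * a ^ (m + q - t) * of_nat (card A) ^ (q - (t - s))"
      by (simp add: g_def mult_ac)
  qed
  finally show ?thesis .
qed

theorem lemma2p1:
  fixes M :: "'w measure"
    and x :: "nat \<Rightarrow> nat \<Rightarrow> real ^ 'p"
    and \<beta> :: "real ^ 'p"
    and n m k i :: nat
  assumes "linear_mixed_model M n l x \<alpha> \<beta> b \<epsilon> y"
    and "1 \<le> m" and "m \<le> k"
    and "i \<in> {1..n}"
    and "\<omega> \<in> space M"
  shows "power_sum_product l (total_error b \<epsilon>) m k i \<omega> =
    (\<Sum>t=0..k. \<Sum>s=nat (max (int t - int k + int m) 0)..min t m.
      real (m choose s) * real ((k - m) choose (t - s))
        * (\<Sum>j=1..l i. \<epsilon> i j \<omega> ^ s) * (\<Sum>j=1..l i. \<epsilon> i j \<omega>) ^ (t - s)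
        * b i \<omega> ^ (k - t) * real (l i) ^ (k - m - (t - s)))"
proof -
  have lower: "nat (max (int t - int k + int m) 0) = t - (k - m)" for t
    using \<open>m \<le> k\<close> by linarith
  have k: "m + (k - m) = k"
    using \<open>m \<le> k\<close> by simp
  show ?thesis
    unfolding power_sum_product_def total_error_def lower
    using power_sum_product_shift[of "b i \<omega>" "\<lambda>j. \<epsilon> i j \<omega>" m "{1..l i}" "k - m"]
    by (simp only: k card_atLeastAtMost diff_Suc_1 atLeast0AtMost)
qed

end
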